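(* Let $n\ge2$, let $P$ be a random orthogonal projector on $\mathbb{R}^n$ taking values $P_1,\dots,P_m$ with probabilities $p_1,\dots,p_m>0$, and assume the smallest eigenvalue $\mu$ of $\mathbb{E}[P]$ is positive. Let $\mathcal{B},\mathcal{C}$, $U$, $\xi$, the set $\mathfrak{C}$ and the superoperator $\mathcal{C}^\star$ be as defined in the context. Then $\mathcal{C}^\star$ eclipses every element of $\mathfrak{C}$ with respect to $\mathcal{B}$: for every $\mathcal{C}'\in\mathfrak{C}$ and every $\omega\in[0,2]$, $$\lambda_{\min}(\mathcal{B}-\omega\,\mathcal{C}^\star)\le\lambda_{\min}(\mathcal{B}-\omega\,\mathcal{C}').$$ Hence $\mathcal{C}^\star$ eclipses $\mathcal{C}$, i.e. $\lambda_{\min}(\mathcal{B}-\omega\,\mathcal{C}^\star)\le\lambda_{\min}(\mathcal{B}-\omega\,\mathcal{C})$ for all $\omega\in[0,2]$.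
   Context: $\mathbb{R}^{n\times n}$ carries the Frobenius inner product $\langle M,M'\rangle=\operatorname{tr}(M^TM')$. A superoperator is a linear map on $\mathbb{R}^{n\times n}$; all superoperators here are self-adjoint, $\succcurlyeq$ is the Loewner order and $\lambda_{\min}=\lambda_1$ the smallest eigenvalue. Define $\mathcal{B}(X)=\mathbb{E}[P]X+X\mathbb{E}[P]$ and $\mathcal{C}(X)=\mathbb{E}[PXP]$. Let $\mu\le\mu'$ be the two smallest eigenvalues of $\mathbb{E}[P]$ (with multiplicity), with orthonormal eigenvectors $u,u'$. Put $U:=uu^T$ (a unit eigenvector of $\mathcal{B}$ for its smallest eigenvalue $2\mu$), $U':=u{u'}^T$ (a unit eigenvector of $\mathcal{B}$ for its second smallest eigenvalue $\mu+\mu'$), $\xi:=\langle U,\mathcal{C}(U)\rangle=\mathbb{E}[(u^TPu)^2]$, and $\gamma:=\frac{\mu+\mu'}{2}\left(1-\frac{\xi}{\mu}\right)$. $\mathfrak{C}$ is the set of all superoperators $\mathcal{C}'$ such that: (a) $\mathcal{C}'\succcurlyeq 0$; (b) $\mathcal{C}'\preccurlyeq\mathcal{B}/2$; (c) $\mathcal{C}'$ "kisses" $\mathcal{B}/2$, i.e. $\mathcal{B}/2-\mathcal{C}'$ is positive semidefinite but not positive definite (it has eigenvalue $0$); (d) $\langle U,\mathcal{C}'(U)\rangle=\xi$. The superoperator $\mathcal{C}$ belongs to $\mathfrak{C}$. $\mathcal{C}^\star$ is the rank-one superoperator $\mathcal{C}^\star(X)=\langle W,X\rangle W$ with $W=\sqrt{\gamma}\,U'+\sqrt{\xi}\,U$.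 For superoperators $\mathcal{C}',\mathcal{C}''$, "$\mathcal{C}'$ eclipses $\mathcal{C}''$ with respect to $\mathcal{B}$" means $\lambda_{\min}(\mathcal{B}-\omega\mathcal{C}')\le\lambda_{\min}(\mathcal{B}-\omega\mathcal{C}'')$ for all $\omega\in[0,2]$. *)

theory Defs
  imports "HOL-Analysis.Analysis" "HOL-Probability.Probability_Mass_Function" "HOL-Library.Multiset"
begin

text \<open>
  Matrices are elements of \<open>real^'n^'n\<close>, whose library inner product \<open>(\<bullet>)\<close> is the Frobenius inner
  product; superoperators are functions on that Euclidean space.
\<close>

lemma frobenius_inner: "(M :: real^'n^'n) \<bullet> M' = trace (transpose M ** M')"
  unfolding inner_vec_def trace_def transpose_def matrix_matrix_mult_def
  by (simp add: sum.swap[of "\<lambda>i j. M $ i $ j * M' $ i $ j"])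

definition self_adjoint :: "('a::euclidean_space \<Rightarrow> 'a) \<Rightarrow> bool" where
  "self_adjoint f \<longleftrightarrow> linear f \<and> adjoint f = f"

definition pos_semidefinite :: "('a::euclidean_space \<Rightarrow> 'a) \<Rightarrow> bool" where
  "pos_semidefinite f \<longleftrightarrow> self_adjoint f \<and> (\<forall>x. 0 \<le> x \<bullet> f x)"

definition pos_definite :: "('a::euclidean_space \<Rightarrow> 'a) \<Rightarrow> bool" where
  "pos_definite f \<longleftrightarrow> self_adjoint f \<and> (\<forall>x. x \<noteq> 0 \<longrightarrow> 0 < x \<bullet> f x)"

definition loewner_le :: "('a::euclidean_space \<Rightarrow> 'a) \<Rightarrow> ('a \<Rightarrow> 'a) \<Rightarrow> bool"  (infix \<open>\<preceq>\<^sub>L\<close> 50) where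
  "f \<preceq>\<^sub>L g \<longleftrightarrow> pos_semidefinite (\<lambda>x. g x - f x)"

definition eigenvalues :: "('a::euclidean_space \<Rightarrow> 'a) \<Rightarrow> real set" where
  "eigenvalues f = {l. \<exists>v. v \<noteq> 0 \<and> f v = l *\<^sub>R v}"

lemma finite_eigenvalues:
  assumes "self_adjoint f"
  shows "finite (eigenvalues f)"
proof -
  define e where "e l = (SOME v. v \<noteq> 0 \<and> f v = l *\<^sub>R v)" for l
  have e: "e l \<noteq> 0" "f (e l) = l *\<^sub>R e l" if "l \<in> eigenvalues f" for l
    using someI_ex[of "\<lambda>v. v \<noteq> 0 \<and> f v = l *\<^sub>R v"] that by (auto simp: eigenvalues_def e_def)
  have "f x \<bullet> y = x \<bullet> f y" for x y
    using assms adjoint_works[of f y x] by (metis self_adjoint_def inner_commute)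
  then have orth: "e l \<bullet> e k = 0" if "l \<in> eigenvalues f" "k \<in> eigenvalues f" "l \<noteq> k" for l k
    using e[OF that(1)] e[OF that(2)] that(3) by (metis inner_scaleR_left inner_scaleR_right mult_cancel_right)
  have "inj_on e (eigenvalues f)"
    using orth e(1) by (metis inj_onI inner_eq_zero_iff)
  moreover have "finite (e ` eigenvalues f)"
    by (rule pairwise_orthogonal_imp_finite) (auto simp: pairwise_def orthogonal_def intro: orth)
  ultimately show ?thesis
    by (metis finite_imageD)
qed

definition lambda_min :: "('a::euclidean_space \<Rightarrow> 'a) \<Rightarrow> real" where
  "lambda_min f = Min (eigenvalues f)"

text \<open>
  The eigenvalues in increasing order, each repeated as often as the dimension of its eigenspace
  (for self-adjoint maps, the only ones considered, this is also the algebraic multiplicity).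
\<close>
definition eigenvalue_list :: "('a::euclidean_space \<Rightarrow> 'a) \<Rightarrow> real list" where
  "eigenvalue_list f =
     sorted_list_of_multiset (\<Sum>l\<in>eigenvalues f. replicate_mset (dim {v. f v = l *\<^sub>R v}) l)"

definition orthogonal_projector :: "real^'n^'n \<Rightarrow> bool" where
  "orthogonal_projector Q \<longleftrightarrow> Q ** Q = Q \<and> transpose Q = Q"

definition outer :: "real^'n \<Rightarrow> real^'n \<Rightarrow> real^'n^'n" where
  "outer v w = (\<chi> i j. v $ i * w $ j)"

text \<open>In the following, \<open>D\<close> is the distribution of the random matrix \<open>P\<close>.\<close>

definition mean_matrix :: "(real^'n^'n) pmf \<Rightarrow> real^'n^'n" where
  "mean_matrix D = measure_pmf.expectation D (\<lambda>P. P)"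

definition op_B :: "(real^'n^'n) pmf \<Rightarrow> real^'n^'n \<Rightarrow> real^'n^'n" where
  "op_B D X = mean_matrix D ** X + X ** mean_matrix D"

definition op_C :: "(real^'n^'n) pmf \<Rightarrow> real^'n^'n \<Rightarrow> real^'n^'n" where
  "op_C D X = measure_pmf.expectation D (\<lambda>P. P ** X ** P)"

definition kisses :: "('a::euclidean_space \<Rightarrow> 'a) \<Rightarrow> ('a \<Rightarrow> 'a) \<Rightarrow> bool" where
  "kisses f g \<longleftrightarrow> pos_semidefinite (\<lambda>x. g x - f x) \<and> \<not> pos_definite (\<lambda>x. g x - f x)"

definition frak_C :: "(real^'n^'n \<Rightarrow> real^'n^'n) \<Rightarrow> real^'n^'n \<Rightarrow> real
    \<Rightarrow> (real^'n^'n \<Rightarrow> real^'n^'n) set" where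
  "frak_C B U \<xi> = {C'. self_adjoint C'
      \<and> (\<lambda>X. 0) \<preceq>\<^sub>L C'
      \<and> C' \<preceq>\<^sub>L (\<lambda>X. B X /\<^sub>R 2)
      \<and> kisses C' (\<lambda>X. B X /\<^sub>R 2)
      \<and> U \<bullet> C' U = \<xi>}"

definition gamma_coeff :: "real \<Rightarrow> real \<Rightarrow> real \<Rightarrow> real" where
  "gamma_coeff \<mu> \<mu>' \<xi> = (\<mu> + \<mu>') / 2 * (1 - \<xi> / \<mu>)"

definition rank_one_op :: "'a::euclidean_space \<Rightarrow> 'a \<Rightarrow> 'a" where
  "rank_one_op W X = (W \<bullet> X) *\<^sub>R W"

definition op_Cstar :: "(real^'n^'n) pmf \<Rightarrow> real \<Rightarrow> real \<Rightarrow> real^'n \<Rightarrow> real^'n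
    \<Rightarrow> real^'n^'n \<Rightarrow> real^'n^'n" where
  "op_Cstar D \<mu> \<mu>' u u' =
     (let U = outer u u; U' = outer u u'; \<xi> = U \<bullet> op_C D U; \<gamma> = gamma_coeff \<mu> \<mu>' \<xi>
      in rank_one_op (sqrt \<gamma> *\<^sub>R U' + sqrt \<xi> *\<^sub>R U))"

definition eclipses :: "('a::euclidean_space \<Rightarrow> 'a) \<Rightarrow> ('a \<Rightarrow> 'a) \<Rightarrow> ('a \<Rightarrow> 'a) \<Rightarrow> bool" where
  "eclipses B C' C'' \<longleftrightarrow>
     (\<forall>\<omega>\<in>{0..2}. lambda_min (\<lambda>X. B X - \<omega> *\<^sub>R C' X) \<le> lambda_min (\<lambda>X. B X - \<omega> *\<^sub>R C'' X))"

end

theory Submission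
  imports Defs
begin

text \<open>
  Let \<open>L\<close> be the smallest eigenvalue of \<open>\<B> - \<omega> \<C>\<^sup>\<star>\<close> and \<open>X = a U + V\<close> with \<open>V\<close> orthogonal to \<open>U\<close>; only
  the case \<open>L \<ge> 0\<close> matters. With \<open>\<zeta> = \<langle>V, \<C>' V\<rangle>\<close>, \<open>\<eta> = \<langle>U, \<C>' V\<rangle>\<close> and \<open>T = \<langle>V, \<B> V\<rangle> / 2\<close>, the Cauchy--Schwarz
  inequalities for \<open>\<C>'\<close> and \<open>\<B>/2 - \<C>'\<close> read \<open>\<eta>\<^sup>2 \<le> \<xi> \<zeta>\<close> and \<open>\<eta>\<^sup>2 \<le> (\<mu> - \<xi>) (T - \<zeta>)\<close>. The determinant of
  the binary form of \<open>\<B> - \<omega> \<C>' - L\<close> on \<open>U, V\<close> is, after eliminating \<open>\<zeta>\<close>, affine in \<open>\<eta>\<^sup>2\<close>; at the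
  extreme admissible \<open>\<eta>\<^sup>2\<close> it is also affine in \<open>T\<close>, and at the least admissible value
  \<open>T = \<parallel>V\<parallel>\<^sup>2 (\<mu> + \<mu>') / 2\<close> it is a multiple of the one for \<open>\<C>\<^sup>\<star>\<close> on \<open>U, U'\<close>, which is nonnegative.

  The bound \<open>\<langle>V, \<B> V\<rangle> \<ge> (\<mu> + \<mu>') \<parallel>V\<parallel>\<^sup>2\<close> reduces to \<open>\<parallel>V\<^sup>T u\<parallel>\<^sup>2 + \<parallel>V u\<parallel>\<^sup>2 \<le> \<parallel>V\<parallel>\<^sup>2\<close>, which avoids an eigenbasis.
\<close>

section \<open>Quadratic forms of self-adjoint maps\<close>

lemma binary_form_nonneg:
  fixes p q r a b :: real
  assumes "0 \<le> p" "0 \<le> r" "q\<^sup>2 \<le> p * r"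
  shows "0 \<le> p * a\<^sup>2 + 2 * q * (a * b) + r * b\<^sup>2"
proof (cases "p = 0")
  case True
  then show ?thesis using assms by simp
next
  case False
  have "p * (p * a\<^sup>2 + 2 * q * (a * b) + r * b\<^sup>2) = (p * a + q * b)\<^sup>2 + (p * r - q\<^sup>2) * b\<^sup>2"
    by (simp add: power2_eq_square algebra_simps)
  also have "0 \<le> \<dots>" using assms by simp
  finally show ?thesis using False assms by (simp add: zero_le_mult_iff)
qed

text \<open>Source of the Cauchy-Schwarz inequalities below and of the determinant condition for the
  rank-one map.\<close>

lemma binary_form_discriminant:
  fixes p q r :: real
  assumes nn: "\<And>a b. 0 \<le> p * a\<^sup>2 + 2 * q * (a * b) + r * b\<^sup>2"
  shows "q\<^sup>2 \<le> p * r"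
proof -
  have p: "0 \<le> p" using nn[of 1 0] by simp
  show ?thesis
  proof (cases "p = 0")
    case True
    \<comment> \<open>With \<open>p = 0\<close> the form is affine in \<open>a\<close>; its value at
      \<open>a = -(r + 1)\<close>, \<open>b = q\<close> is -(r + 2) times the square of
      \<open>q\<close>, which forces \<open>q = 0\<close>.\<close>
    have "0 \<le> 2 * q * (-(r + 1) * q) + r * q\<^sup>2" "0 \<le> r"
      using nn[of "-(r + 1)" q] nn[of 0 1] True by (simp_all add: mult.assoc)
    then have "0 \<le> - ((r + 2) * q\<^sup>2)" by (simp add: power2_eq_square algebra_simps)
    then show ?thesis using \<open>0 \<le> r\<close> True by (simp add: mult_le_0_iff)
  next
    case False
    \<comment> \<open>The vector \<open>(-q, p)\<close> annihilates the completed square, so only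
      the determinant survives.\<close>
    have "0 \<le> p * (p * r - q\<^sup>2)"
      using nn[of "-q" p] by (simp add: power2_eq_square algebra_simps)
    then show ?thesis using False p by (simp add: zero_le_mult_iff)
  qed
qed

lemma self_adjointI:
  fixes f :: "'a::euclidean_space \<Rightarrow> 'a"
  assumes "linear f" "\<And>x y. f x \<bullet> y = x \<bullet> f y"
  shows "self_adjoint f"
  unfolding self_adjoint_def using assms adjoint_unique[of f f] by metis

lemma self_adjoint_inner:
  assumes "self_adjoint f"
  shows "f x \<bullet> y = x \<bullet> f y"
  using assms adjoint_works[of f y x] by (metis self_adjoint_def inner_commute)

lemma self_adjoint_linear: "self_adjoint f \<Longrightarrow> linear f"
  by (simp add: self_adjoint_def)

lemma self_adjoint_diff_scaled:
  assumes "self_adjoint f" "self_adjoint g"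
  shows "self_adjoint (\<lambda>x. f x - c *\<^sub>R g x)"
proof (rule self_adjointI)
  show "linear (\<lambda>x. f x - c *\<^sub>R g x)"
    using assms by (intro linear_compose_sub linear_compose_scale_right self_adjoint_linear)
  show "(f x - c *\<^sub>R g x) \<bullet> y = x \<bullet> (f y - c *\<^sub>R g y)" for x y
    using assms by (simp add: inner_diff self_adjoint_inner)
qed

lemma quadratic_form_add:
  assumes "self_adjoint f"
  shows "(a *\<^sub>R x + b *\<^sub>R y) \<bullet> f (a *\<^sub>R x + b *\<^sub>R y)
       = (x \<bullet> f x) * a\<^sup>2 + 2 * (x \<bullet> f y) * (a * b) + (y \<bullet> f y) * b\<^sup>2"
proof -
  have "y \<bullet> f x = x \<bullet> f y"
    using self_adjoint_inner[OF assms] by (metis inner_commute)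
  then show ?thesis
    using self_adjoint_linear[OF assms]
    by (simp add: linear_add linear_scale inner_add power2_eq_square algebra_simps)
qed

lemma pos_semidefinite_cauchy:
  assumes "pos_semidefinite f"
  shows "(x \<bullet> f y)\<^sup>2 \<le> (x \<bullet> f x) * (y \<bullet> f y)"
proof (rule binary_form_discriminant)
  fix a b :: real
  show "0 \<le> (x \<bullet> f x) * a\<^sup>2 + 2 * (x \<bullet> f y) * (a * b) + (y \<bullet> f y) * b\<^sup>2"
    using assms quadratic_form_add[of f a x b y] unfolding pos_semidefinite_def by metis
qed

text \<open>The Rayleigh quotient attains its minimum on the compact unit sphere of
  \<open>S\<close>. Cauchy-Schwarz for the shifted form makes the residual \<open>f v - l v\<close>
  orthogonal to \<open>S\<close>; invariance puts it in \<open>S\<close>, so it is zero. The whole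
  space serves \<open>lambda_min\<close>, the hyperplane orthogonal to \<open>u\<close> the second
  eigenvalue.\<close>

lemma exists_min_eigenvector_on_subspace:
  fixes f :: "'a::euclidean_space \<Rightarrow> 'a"
  assumes sa: "self_adjoint f" and S: "subspace S" and inv: "\<And>x. x \<in> S \<Longrightarrow> f x \<in> S"
    and z: "z \<in> S" "z \<noteq> 0"
  obtains v l where "v \<in> S" "norm v = 1" "f v = l *\<^sub>R v"
    "\<And>x. x \<in> S \<Longrightarrow> l * (x \<bullet> x) \<le> x \<bullet> f x"
proof -
  let ?K = "S \<inter> sphere 0 1"
  have lin: "linear f" using sa by (rule self_adjoint_linear)
  have "compact ?K"
    using closed_subspace[OF S] by (simp add: closed_Int_compact)
  moreover have "z /\<^sub>R norm z \<in> ?K"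
    using z S by (simp add: subspace_scale)
  moreover have "continuous_on ?K (\<lambda>x. x \<bullet> f x)"
    using lin by (intro continuous_intros linear_continuous_on) (simp add: linear_conv_bounded_linear)
  ultimately obtain v where v: "v \<in> ?K" and vmin: "\<And>x. x \<in> ?K \<Longrightarrow> v \<bullet> f v \<le> x \<bullet> f x"
    using continuous_attains_inf[of ?K "\<lambda>x. x \<bullet> f x"] by blast
  define l where "l = v \<bullet> f v"
  have vS: "v \<in> S" and nv: "norm v = 1" using v by auto
  have vv: "v \<bullet> v = 1" using nv by (simp add: norm_eq_1)
  have bound: "l * (x \<bullet> x) \<le> x \<bullet> f x" if "x \<in> S" for x
  proof (cases "x = 0")
    case False
    then have "x /\<^sub>R norm x \<in> ?K" using that S by (simp add: subspace_scale)
    from vmin[OF this] have "l \<le> (x \<bullet> f x) / (norm x)\<^sup>2"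
      using lin by (simp add: l_def linear_scale power2_eq_square divide_simps)
    then show ?thesis using False by (simp add: divide_simps power2_norm_eq_inner)
  qed (simp add: linear_0[OF lin])
  have key: "w \<bullet> (f v - l *\<^sub>R v) = 0" if w: "w \<in> S" for w
  proof -
    have g: "self_adjoint (\<lambda>x. f x - l *\<^sub>R x)"
      by (rule self_adjoint_diff_scaled[OF sa]) (simp add: self_adjointI linear_id[unfolded id_def])
    \<comment> \<open>The shifted form is known to be nonnegative on \<open>S\<close> only, so the
      discriminant is taken on combinations of \<open>w\<close> and \<open>v\<close>. The last
      factor is zero by the choice of \<open>l\<close>.\<close>
    have "(w \<bullet> (f v - l *\<^sub>R v))\<^sup>2 \<le> (w \<bullet> (f w - l *\<^sub>R w)) * (v \<bullet> (f v - l *\<^sub>R v))"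
    proof (rule binary_form_discriminant)
      fix a b :: real
      have "a *\<^sub>R w + b *\<^sub>R v \<in> S"
        using w vS S by (simp add: subspace_add subspace_scale)
      from bound[OF this]
      show "0 \<le> (w \<bullet> (f w - l *\<^sub>R w)) * a\<^sup>2 + 2 * (w \<bullet> (f v - l *\<^sub>R v)) * (a * b)
          + (v \<bullet> (f v - l *\<^sub>R v)) * b\<^sup>2"
        unfolding quadratic_form_add[OF g, symmetric] by (simp only: inner_diff_right) simp
    qed
    then show ?thesis by (simp add: inner_diff_right l_def[symmetric] vv)
  qed
  have "f v - l *\<^sub>R v \<in> S"
    using vS S inv by (simp add: subspace_diff subspace_scale)
  from key[OF this] have "f v = l *\<^sub>R v" by simp
  with that vS nv bound show thesis by blast
qed

text \<open>The Rayleigh minimiser contributes an eigenvalue, and testing the bound on any other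
  eigenvector shows that it is the least one.\<close>

lemma lambda_min_variational:
  fixes f :: "'a::euclidean_space \<Rightarrow> 'a"
  assumes sa: "self_adjoint f"
  shows "lambda_min f * (x \<bullet> x) \<le> x \<bullet> f x"
    and "\<exists>v. norm v = 1 \<and> f v = lambda_min f *\<^sub>R v"
proof -
  obtain z :: 'a where "z \<noteq> 0" using nonempty_Basis nonzero_Basis by blast
  then obtain v l where v: "norm v = 1" "f v = l *\<^sub>R v"
    and l: "\<And>x. l * (x \<bullet> x) \<le> x \<bullet> f x"
    using exists_min_eigenvector_on_subspace[OF sa subspace_UNIV] by (metis UNIV_I)
  have "lambda_min f = l"
    unfolding lambda_min_def
  proof (rule Min_eqI[OF finite_eigenvalues[OF sa]])
    have "v \<noteq> 0" using v by auto
    then show "l \<in> eigenvalues f" using v by (auto simp: eigenvalues_def)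
    fix k assume "k \<in> eigenvalues f"
    then obtain w where "w \<noteq> 0" "f w = k *\<^sub>R w" by (auto simp: eigenvalues_def)
    with l[of w] show "l \<le> k" by simp
  qed
  then show "lambda_min f * (x \<bullet> x) \<le> x \<bullet> f x" "\<exists>v. norm v = 1 \<and> f v = lambda_min f *\<^sub>R v"
    using v l by auto
qed

section \<open>The two smallest eigenvalues\<close>

text \<open>If the second entry exceeded \<open>b\<close>, at most the first entry could be \<le>
  \<open>b\<close>, but \<open>a\<close> and \<open>b\<close> both are. Multiset inclusion lets
  \<open>a = b\<close> count twice.\<close>

lemma sorted_two_smallest:
  fixes a b :: "'a::linorder"
  assumes "sorted xs" "{#a, b#} \<subseteq># mset xs" "a \<le> b"
  shows "xs ! 1 \<le> b" "xs ! 0 \<le> xs ! 1"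
proof -
  have "2 \<le> length xs" using size_mset_mono[OF assms(2)] by simp
  then obtain x y zs where xs: "xs = x # y # zs"
    by (metis Suc_le_length_iff numeral_2_eq_2)
  show "xs ! 0 \<le> xs ! 1" using assms(1) xs by simp
  show "xs ! 1 \<le> b"
  proof (rule ccontr)
    assume "\<not> xs ! 1 \<le> b"
    then have "filter_mset (\<lambda>t. t \<le> b) (mset (y # zs)) = {#}"
      using assms(1) xs by auto
    then have "size (filter_mset (\<lambda>t. t \<le> b) (mset xs)) \<le> 1"
      using xs by simp
    moreover have "filter_mset (\<lambda>t. t \<le> b) {#a, b#} \<subseteq># filter_mset (\<lambda>t. t \<le> b) (mset xs)"
      by (rule multiset_filter_mono[OF assms(2)])
    ultimately show False
      using assms(3) size_mset_mono by fastforce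
  qed
qed

lemma mset_eigenvalue_list_count:
  fixes f :: "'a::euclidean_space \<Rightarrow> 'a"
  assumes "self_adjoint f" "l \<in> eigenvalues f"
  shows "count (mset (eigenvalue_list f)) l = dim {v. f v = l *\<^sub>R v}"
proof -
  have "count (mset (eigenvalue_list f)) l
      = (\<Sum>k\<in>eigenvalues f. if l = k then dim {v. f v = k *\<^sub>R v} else 0)"
    unfolding eigenvalue_list_def by (simp add: count_sum eq_commute cong: if_cong)
  then show ?thesis using assms finite_eigenvalues[OF assms(1)] by simp
qed

text \<open>Orthogonality makes the two eigenvalues occupy two places of the list: if they coincide,
  \<open>u\<close> and \<open>w\<close> are independent in one eigenspace, so its multiplicity is at
  least 2.\<close>

lemma second_eigenvalue_le:
  fixes f :: "'a::euclidean_space \<Rightarrow> 'a"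
  assumes sa: "self_adjoint f" and u: "norm u = 1" "f u = (eigenvalue_list f ! 0) *\<^sub>R u"
    and w: "norm w = 1" "f w = l *\<^sub>R w" and orth: "u \<bullet> w = 0"
  shows "eigenvalue_list f ! 1 \<le> l" "eigenvalue_list f ! 0 \<le> eigenvalue_list f ! 1"
proof -
  define xs where "xs = eigenvalue_list f"
  define k where "k = xs ! 0"
  have srt: "sorted xs" unfolding xs_def eigenvalue_list_def by simp
  have nz: "u \<noteq> 0" "w \<noteq> 0" using u w by auto
  have ev: "k \<in> eigenvalues f" "l \<in> eigenvalues f"
    using nz u w unfolding eigenvalues_def k_def xs_def by auto
  note cnt = mset_eigenvalue_list_count[OF sa, folded xs_def]
  have card_le: "card B \<le> count (mset xs) m"
    if "m \<in> eigenvalues f" "independent B" "\<And>v. v \<in> B \<Longrightarrow> f v = m *\<^sub>R v" for B m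
    unfolding cnt[OF that(1)] by (rule independent_card_le_dim) (use that in auto)
  have lpos: "1 \<le> count (mset xs) l" and kpos: "1 \<le> count (mset xs) k"
    using card_le[OF ev(2), of "{w}"] card_le[OF ev(1), of "{u}"] nz u w
    by (auto simp: k_def xs_def)
  have "l \<in> set xs" using lpos by (metis count_mset_0_iff not_one_le_zero)
  then have kl: "k \<le> l"
    unfolding k_def using srt by (metis in_set_conv_nth sorted_nth_mono le0)
  have "{#k, l#} \<subseteq># mset xs"
  proof (cases "k = l")
    case True
    have "u \<noteq> w" using orth nz by auto
    moreover have "independent {u, w}"
      by (rule pairwise_orthogonal_independent)
        (use nz orth in \<open>auto simp: pairwise_def orthogonal_def inner_commute\<close>)
    ultimately have "2 \<le> count (mset xs) k"
      using card_le[OF ev(1), of "{u, w}"] u(2) w(2) True[symmetric]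
      unfolding k_def xs_def by (auto simp: numeral_2_eq_2)
    then show ?thesis using True by (auto simp: subseteq_mset_def)
  next
    case False
    then show ?thesis using lpos kpos by (auto simp: subseteq_mset_def)
  qed
  from sorted_two_smallest[OF srt this kl]
  show "eigenvalue_list f ! 1 \<le> l" "eigenvalue_list f ! 0 \<le> eigenvalue_list f ! 1"
    by (auto simp: xs_def)
qed

text \<open>The minimum over the hyperplane orthogonal to \<open>u\<close> is an eigenvalue with an
  eigenvector orthogonal to \<open>u\<close>, hence at least the second entry. The vector
  \<open>z\<close> shows that this hyperplane is not zero.\<close>

lemma quadratic_form_second_eigenvalue:
  fixes f :: "'a::euclidean_space \<Rightarrow> 'a"
  assumes sa: "self_adjoint f" and u: "norm u = 1" "f u = (eigenvalue_list f ! 0) *\<^sub>R u"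
    and z: "z \<noteq> 0" "u \<bullet> z = 0"
  shows "eigenvalue_list f ! 0 \<le> eigenvalue_list f ! 1"
    and "u \<bullet> y = 0 \<Longrightarrow> eigenvalue_list f ! 1 * (y \<bullet> y) \<le> y \<bullet> f y"
proof -
  let ?S = "{x. u \<bullet> x = 0}"
  have "u \<bullet> f x = 0" if "u \<bullet> x = 0" for x
    using self_adjoint_inner[OF sa, of u x] u that by simp
  then obtain w l where w: "w \<in> ?S" "norm w = 1" "f w = l *\<^sub>R w"
    and l: "\<And>x. x \<in> ?S \<Longrightarrow> l * (x \<bullet> x) \<le> x \<bullet> f x"
    using exists_min_eigenvector_on_subspace[OF sa subspace_hyperplane, of u z] z by auto
  note second = second_eigenvalue_le[OF sa u w(2,3)]
  show "eigenvalue_list f ! 0 \<le> eigenvalue_list f ! 1" using second w by simp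
  assume "u \<bullet> y = 0"
  then have "l * (y \<bullet> y) \<le> y \<bullet> f y" using l by simp
  moreover have "eigenvalue_list f ! 1 * (y \<bullet> y) \<le> l * (y \<bullet> y)"
    using second w by (intro mult_right_mono) auto
  ultimately show "eigenvalue_list f ! 1 * (y \<bullet> y) \<le> y \<bullet> f y" by simp
qed

section \<open>The eigenvalue comparison in two dimensions\<close>

text \<open>Here \<open>s\<close> is half the second eigenvalue of \<open>B\<close> and
  \<open>v\<close> the squared norm of \<open>V\<close>. \<open>A\<close> and the first conclusion
  are the diagonal entries of the form of \<open>B - \<omega> C' - L\<close> on \<open>U\<close>,
  \<open>V\<close>; the second conclusion is its determinant condition. The assumption
  \<open>det\<close> is the same condition for the rank-one map on \<open>U\<close>,
  \<open>U'\<close>.\<close>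

lemma kissing_determinant_bound:
  fixes \<mu> \<xi> \<omega> L s T v \<zeta> \<eta> :: real
  defines "A \<equiv> 2 * \<mu> - \<omega> * \<xi> - L" and "\<gamma> \<equiv> s * (1 - \<xi> / \<mu>)"
  assumes \<mu>: "0 < \<mu>" and \<xi>: "0 \<le> \<xi>" "\<xi> \<le> \<mu>" and \<omega>: "0 \<le> \<omega>" "\<omega> \<le> 2"
    and L: "0 \<le> L" "L \<le> (2 - \<omega>) * s" and s: "0 < s" and v: "0 \<le> v" "s * v \<le> T"
    and \<zeta>: "\<zeta> \<le> T" and \<eta>: "\<eta>\<^sup>2 \<le> \<xi> * \<zeta>" "\<eta>\<^sup>2 \<le> (\<mu> - \<xi>) * (T - \<zeta>)"
    and A: "0 \<le> A" and det: "\<omega>\<^sup>2 * \<gamma> * \<xi> \<le> A * (2 * s - \<omega> * \<gamma> - L)"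
  shows "0 \<le> 2 * T - \<omega> * \<zeta> - L * v" "(\<omega> * \<eta>)\<^sup>2 \<le> A * (2 * T - \<omega> * \<zeta> - L * v)"
proof -
  have Lv: "L * v \<le> (2 - \<omega>) * T"
  proof -
    have "L * v \<le> (2 - \<omega>) * s * v" using L v by (intro mult_right_mono)
    also have "\<dots> = (2 - \<omega>) * (s * v)" by simp
    also have "\<dots> \<le> (2 - \<omega>) * T" using v \<omega> by (intro mult_left_mono) auto
    finally show ?thesis .
  qed
  have "\<omega> * \<zeta> \<le> \<omega> * T" using \<zeta> \<omega> by (intro mult_left_mono)
  then show D: "0 \<le> 2 * T - \<omega> * \<zeta> - L * v" using Lv by (simp add: algebra_simps)
  show "(\<omega> * \<eta>)\<^sup>2 \<le> A * (2 * T - \<omega> * \<zeta> - L * v)"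
  proof (cases "\<xi> = \<mu>")
    case True
    then have "\<eta> = 0" using \<eta>(2) by simp
    then show ?thesis using A D by simp
  next
    case False
    then have d: "0 < \<mu> - \<xi>" using \<xi> by simp
    \<comment> \<open>By the second Cauchy-Schwarz bound, \<open>h\<close> is the least admissible
      \<open>T - \<zeta>\<close>. The worst case \<open>\<zeta> = T - h\<close> eliminates
      \<open>\<zeta>\<close>, and the first bound then caps \<open>h\<close>.\<close>
    define h where "h = \<eta>\<^sup>2 / (\<mu> - \<xi>)"
    have hd: "\<eta>\<^sup>2 = h * (\<mu> - \<xi>)" using d by (simp add: h_def)
    have h0: "0 \<le> h" using d by (simp add: h_def)
    have hT: "h \<le> T - \<zeta>" using \<eta>(2) d unfolding hd by (simp add: mult.commute)
    have "h * (\<mu> - \<xi>) \<le> \<xi> * (T - h)"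
      using \<eta>(1) hT mult_left_mono[of \<zeta> "T - h" \<xi>] \<xi> unfolding hd by linarith
    then have h1: "h \<le> \<xi> * T / \<mu>" using \<mu> by (simp add: field_simps)
    have T0: "0 \<le> T" using v s by (meson mult_nonneg_nonneg less_imp_le order_trans)
    \<comment> \<open>The bound is affine in \<open>h\<close>, so it suffices to check the extreme values \<open>0\<close> and \<open>\<xi> * T / \<mu>\<close>.\<close>
    have ends: "0 \<le> A * ((2 - \<omega>) * T - L * v)" using A Lv by simp
    \<comment> \<open>At the upper end \<open>h = \<xi> * T / \<mu>\<close> the determinant equals
      \<open>slope * T - A * L * v\<close>. For \<open>T = s\<close>, \<open>v = 1\<close> there,
      \<open>T - h\<close> is \<open>\<gamma>\<close>, so \<open>det\<close> is exactly the claim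
      \<open>sl\<close>.\<close>
    define slope where "slope = A * (2 - \<omega> + \<omega> * \<xi> / \<mu>) - \<omega>\<^sup>2 * \<xi> * (\<mu> - \<xi>) / \<mu>"
    have sl: "A * L \<le> s * slope"
    proof -
      have "\<omega>\<^sup>2 * \<gamma> * \<xi> = s * (\<omega>\<^sup>2 * \<xi> * (\<mu> - \<xi>) / \<mu>)"
        "A * (2 * s - \<omega> * \<gamma> - L) = s * (A * (2 - \<omega> + \<omega> * \<xi> / \<mu>)) - A * L"
        using \<mu> by (simp_all add: \<gamma>_def field_simps)
      then show ?thesis using det by (simp add: slope_def algebra_simps)
    qed
    then have "0 \<le> s * slope" using A L by (meson mult_nonneg_nonneg order_trans)
    then have sl0: "0 \<le> slope" using s by (simp add: zero_le_mult_iff)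
    have "A * L * v \<le> s * slope * v" using sl v by (intro mult_right_mono)
    also have "\<dots> = slope * (s * v)" by simp
    also have "\<dots> \<le> slope * T" using sl0 v by (intro mult_left_mono)
    finally have top: "A * L * v \<le> slope * T" .
    \<comment> \<open>The coefficient of \<open>h\<close> in the difference of the two sides is
      \<open>\<omega> * (A - \<omega> * (\<mu> - \<xi>))\<close>; its sign decides which end is the
      worse one.\<close>
    have main: "\<omega>\<^sup>2 * (h * (\<mu> - \<xi>)) \<le> A * ((2 - \<omega>) * T + \<omega> * h - L * v)"
    proof (cases "\<omega> * (\<mu> - \<xi>) \<le> A")
      case True
      have "(\<omega> * h) * (\<omega> * (\<mu> - \<xi>)) \<le> (\<omega> * h) * A"
        using True \<omega> h0 by (intro mult_left_mono) auto
      then show ?thesis using ends by (simp add: power2_eq_square algebra_simps)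
    next
      case False
      have "(\<omega> * (\<omega> * (\<mu> - \<xi>) - A)) * h \<le> (\<omega> * (\<omega> * (\<mu> - \<xi>) - A)) * (\<xi> * T / \<mu>)"
        using False \<omega> h1 by (intro mult_left_mono) auto
      moreover have "slope * T - A * ((2 - \<omega>) * T)
          = - ((\<omega> * (\<omega> * (\<mu> - \<xi>) - A)) * (\<xi> * T / \<mu>))"
        using \<mu> by (simp add: slope_def field_simps power2_eq_square)
      ultimately show ?thesis using top by (simp add: power2_eq_square algebra_simps)
    qed
    have "\<omega> * h \<le> \<omega> * (T - \<zeta>)" using hT \<omega> by (intro mult_left_mono)
    then have "A * ((2 - \<omega>) * T + \<omega> * h - L * v) \<le> A * (2 * T - \<omega> * \<zeta> - L * v)"
      using A by (intro mult_left_mono) (simp_all add: algebra_simps)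
    then show ?thesis using main by (simp add: power_mult_distrib hd)
  qed
qed

text \<open>On a vector where \<open>B/2\<close> and the rank-one map have equal forms, the form of
  \<open>B - \<omega> C\<close> is 2 - \<omega> times that of \<open>B/2\<close>, whose Rayleigh
  quotient there is at most \<open>s\<close>. This secures the lower diagonal entry in
  \<open>kissing_determinant_bound\<close>.\<close>

lemma kissing_kernel_bound:
  fixes \<mu> \<xi> \<omega> L s :: real
  defines "\<gamma> \<equiv> s * (1 - \<xi> / \<mu>)"
  assumes \<mu>: "0 < \<mu>" "\<mu> \<le> s" and \<xi>: "0 \<le> \<xi>" "\<xi> \<le> \<mu>" and L: "0 \<le> L"
    and form: "\<And>a b. L * (a\<^sup>2 + b\<^sup>2) \<le> 2 * \<mu> * a\<^sup>2 + 2 * s * b\<^sup>2 - \<omega> * (sqrt \<xi> * a + sqrt \<gamma> * b)\<^sup>2"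
  shows "L \<le> (2 - \<omega>) * s"
proof -
  \<comment> \<open>\<open>(a, b)\<close> spans the kernel of the compression of \<open>\<B>/2 - \<C>\<^sup>\<star>\<close> to the span of \<open>U\<close> and \<open>U'\<close>.\<close>
  define a b where "a = sqrt (s * \<xi>)" and "b = sqrt (\<mu> * (\<mu> - \<xi>))"
  have s: "0 < s" using \<mu> by simp
  have g: "\<gamma> = s * (\<mu> - \<xi>) / \<mu>" using \<mu> by (simp add: \<gamma>_def field_simps)
  have sq: "a\<^sup>2 = s * \<xi>" "b\<^sup>2 = \<mu> * (\<mu> - \<xi>)" using s \<mu> \<xi> by (simp_all add: a_def b_def)
  have "sqrt \<xi> * a = sqrt s * \<xi>"
    using \<xi> by (simp add: a_def real_sqrt_mult)
  moreover have "sqrt \<gamma> * b = sqrt s * (\<mu> - \<xi>)"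
  proof -
    have "sqrt \<gamma> * b = sqrt (s * (\<mu> - \<xi>)\<^sup>2)"
      unfolding b_def g real_sqrt_mult[symmetric] using \<mu> by (simp add: power2_eq_square)
    then show ?thesis using \<xi> by (simp add: real_sqrt_mult)
  qed
  ultimately have "(sqrt \<xi> * a + sqrt \<gamma> * b)\<^sup>2 = (sqrt s * \<mu>)\<^sup>2"
    by (simp add: algebra_simps)
  also have "\<dots> = s * \<mu>\<^sup>2" using s by (simp add: power_mult_distrib)
  finally have "L * (s * \<xi> + \<mu> * (\<mu> - \<xi>)) \<le> (2 - \<omega>) * s * \<mu>\<^sup>2"
    using form[of a b] unfolding sq by (simp add: power2_eq_square algebra_simps)
  moreover have "\<mu>\<^sup>2 \<le> s * \<xi> + \<mu> * (\<mu> - \<xi>)"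
    using mult_right_mono[OF \<mu>(2) \<xi>(1)] by (simp add: power2_eq_square algebra_simps)
  ultimately have "L * \<mu>\<^sup>2 \<le> (2 - \<omega>) * s * \<mu>\<^sup>2"
    using L by (meson mult_left_mono order_trans)
  then show ?thesis using \<mu> by simp
qed

text \<open>The matrix structure enters only through the eigenvectors \<open>U\<close>,
  \<open>U'\<close> of \<open>B\<close> and the gap on the complement of \<open>U\<close>. It
  suffices that \<open>L\<close> bounds the Rayleigh quotient of \<open>G\<close> from
  below.\<close>

lemma kissing_rank_one_eclipses:
  fixes B C :: "'a::euclidean_space \<Rightarrow> 'a" and U U' :: 'a and s \<mu> :: real
  defines "\<xi> \<equiv> U \<bullet> C U" and "\<gamma> \<equiv> s * (1 - U \<bullet> C U / \<mu>)"
  assumes B: "self_adjoint B" and C: "pos_semidefinite C" and BC: "C \<preceq>\<^sub>L (\<lambda>X. B X /\<^sub>R 2)"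
    and U: "U \<bullet> U = 1" "U' \<bullet> U' = 1" "U \<bullet> U' = 0"
    and BU: "B U = (2 * \<mu>) *\<^sub>R U" "B U' = (2 * s) *\<^sub>R U'"
    and \<mu>: "0 < \<mu>" "\<mu> \<le> s"
    and gap: "\<And>V. U \<bullet> V = 0 \<Longrightarrow> 2 * s * (V \<bullet> V) \<le> V \<bullet> B V"
  shows "eclipses B (rank_one_op (sqrt \<gamma> *\<^sub>R U' + sqrt \<xi> *\<^sub>R U)) C"
  unfolding eclipses_def
proof
  fix \<omega> :: real assume "\<omega> \<in> {0..2}"
  then have \<omega>: "0 \<le> \<omega>" "\<omega> \<le> 2" by auto
  define W where "W = sqrt \<gamma> *\<^sub>R U' + sqrt \<xi> *\<^sub>R U"
  define F where "F = (\<lambda>X. B X - \<omega> *\<^sub>R rank_one_op W X)"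
  define G where "G = (\<lambda>X. B X - \<omega> *\<^sub>R C X)"
  define L where "L = lambda_min F"
  have psd: "pos_semidefinite (\<lambda>X. B X /\<^sub>R 2 - C X)" using BC by (simp add: loewner_le_def)
  have Csa: "self_adjoint C" and Cnn: "\<And>X. 0 \<le> X \<bullet> C X"
    using C by (auto simp: pos_semidefinite_def)
  have Cle: "X \<bullet> C X \<le> (X \<bullet> B X) / 2" for X
    using psd by (simp add: pos_semidefinite_def inner_diff_right)
  have \<xi>: "0 \<le> \<xi>" "\<xi> \<le> \<mu>"
    using Cnn[of U] Cle[of U] U BU by (simp_all add: \<xi>_def)
  have \<gamma>0: "0 \<le> \<gamma>" and s: "0 < s"
    using \<mu> \<xi> unfolding \<gamma>_def \<xi>_def[symmetric] by simp_all
  have "self_adjoint (rank_one_op W)"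
    by (rule self_adjointI)
      (auto simp: rank_one_op_def linear_iff inner_add_right scaleR_add_left inner_commute)
  then have Fsa: "self_adjoint F" unfolding F_def by (rule self_adjoint_diff_scaled[OF B])
  have Gsa: "self_adjoint G" unfolding G_def by (rule self_adjoint_diff_scaled[OF B Csa])
  \<comment> \<open>The rank-one map is tested only on the plane of \<open>U\<close> and
    \<open>U'\<close>; all upper bounds on \<open>L\<close> used for the Rayleigh estimate come from
    here.\<close>
  have FF: "L * (a\<^sup>2 + b\<^sup>2) \<le> 2 * \<mu> * a\<^sup>2 + 2 * s * b\<^sup>2 - \<omega> * (sqrt \<xi> * a + sqrt \<gamma> * b)\<^sup>2" for a b
  proof -
    let ?X = "a *\<^sub>R U + b *\<^sub>R U'"
    have U2: "U' \<bullet> U = 0" using U by (simp add: inner_commute)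
    have "?X \<bullet> ?X = a\<^sup>2 + b\<^sup>2" "W \<bullet> ?X = sqrt \<xi> * a + sqrt \<gamma> * b"
      using U U2 by (simp_all add: W_def inner_add power2_eq_square)
    moreover have "?X \<bullet> B ?X = 2 * \<mu> * a\<^sup>2 + 2 * s * b\<^sup>2"
      unfolding quadratic_form_add[OF B] using U BU by simp
    moreover have "?X \<bullet> F ?X = ?X \<bullet> B ?X - \<omega> * (W \<bullet> ?X)\<^sup>2"
      by (simp add: F_def rank_one_op_def inner_diff_right power2_eq_square inner_commute)
    ultimately show ?thesis
      using lambda_min_variational(1)[OF Fsa, of ?X] by (simp add: L_def)
  qed
  have "L * (X \<bullet> X) \<le> X \<bullet> G X" for X
  proof (cases "0 \<le> L")
    \<comment> \<open>For negative \<open>L\<close> it is enough that \<open>G\<close> is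
      nonnegative, which follows from \<open>C \<le> B/2\<close> and \<omega> \<le> 2.\<close>
    case False
    have "\<omega> * (X \<bullet> C X) \<le> 2 * (X \<bullet> C X)" using \<omega> Cnn by (intro mult_right_mono)
    then have "0 \<le> X \<bullet> G X" using Cle[of X] by (simp add: G_def inner_diff_right)
    moreover have "L * (X \<bullet> X) \<le> 0" using False by (simp add: mult_nonpos_nonneg)
    ultimately show ?thesis by linarith
  next
    case True
    have L2: "L \<le> (2 - \<omega>) * s"
      using kissing_kernel_bound[OF \<mu> \<xi> True, of \<omega>] FF unfolding \<gamma>_def \<xi>_def by simp
    define A where "A = 2 * \<mu> - \<omega> * \<xi> - L"
    have A0: "0 \<le> A" using FF[of 1 0] \<xi> by (simp add: A_def)
    have "(- (\<omega> * sqrt (\<xi> * \<gamma>)))\<^sup>2 \<le> A * (2 * s - \<omega> * \<gamma> - L)"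
    proof (rule binary_form_discriminant)
      fix a b :: real
      have "(sqrt \<xi> * a + sqrt \<gamma> * b)\<^sup>2 = \<xi> * a\<^sup>2 + 2 * sqrt (\<xi> * \<gamma>) * (a * b) + \<gamma> * b\<^sup>2"
        using \<xi> \<gamma>0 by (simp add: power2_sum power_mult_distrib real_sqrt_mult)
      with FF[of a b]
      show "0 \<le> A * a\<^sup>2 + 2 * - (\<omega> * sqrt (\<xi> * \<gamma>)) * (a * b) + (2 * s - \<omega> * \<gamma> - L) * b\<^sup>2"
        by (simp add: A_def algebra_simps)
    qed
    then have det: "\<omega>\<^sup>2 * \<gamma> * \<xi> \<le> A * (2 * s - \<omega> * \<gamma> - L)"
      using \<xi> \<gamma>0 by (simp add: power_mult_distrib mult_ac)
    define a V where "a = U \<bullet> X" and "V = X - a *\<^sub>R U"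
    have UV: "U \<bullet> V = 0" using U by (simp add: V_def a_def inner_diff_right)
    have X: "X = a *\<^sub>R U + 1 *\<^sub>R V" by (simp add: V_def)
    define T where "T = (V \<bullet> B V) / 2"
    define \<zeta> where "\<zeta> = V \<bullet> C V"
    define \<eta> where "\<eta> = U \<bullet> C V"
    \<comment> \<open>\<open>B\<close> has no cross term between \<open>U\<close> and
      \<open>V\<close>, so the cross term of \<open>B/2 - C\<close> is
      \<open>-\<eta>\<close>.\<close>
    have UBV: "U \<bullet> B V = 0" using self_adjoint_inner[OF B, of U V] BU UV by simp
    have \<eta>1: "\<eta>\<^sup>2 \<le> \<xi> * \<zeta>"
      using pos_semidefinite_cauchy[OF C, of U V] by (simp add: \<eta>_def \<zeta>_def \<xi>_def)
    have \<eta>2: "\<eta>\<^sup>2 \<le> (\<mu> - \<xi>) * (T - \<zeta>)"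
      using pos_semidefinite_cauchy[OF psd, of U V] U BU UBV
      by (simp add: inner_diff_right \<eta>_def \<zeta>_def T_def \<xi>_def)
    have "0 \<le> 2 * T - \<omega> * \<zeta> - L * (V \<bullet> V)"
      "(\<omega> * \<eta>)\<^sup>2 \<le> A * (2 * T - \<omega> * \<zeta> - L * (V \<bullet> V))"
      using kissing_determinant_bound[of \<mu> \<xi> \<omega> L s "V \<bullet> V" T \<zeta> \<eta>] \<mu> \<xi> \<omega> True L2 s gap[OF UV]
        Cle[of V] \<eta>1 \<eta>2 A0 det
      unfolding A_def \<gamma>_def T_def \<zeta>_def \<xi>_def[symmetric] by auto
    then have "0 \<le> A * a\<^sup>2 + 2 * (- (\<omega> * \<eta>)) * (a * 1) + (2 * T - \<omega> * \<zeta> - L * (V \<bullet> V)) * 1\<^sup>2"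
      using A0 by (intro binary_form_nonneg) auto
    moreover have "X \<bullet> X = a\<^sup>2 + V \<bullet> V"
      using U by (simp add: V_def a_def inner_diff power2_eq_square inner_commute algebra_simps)
    moreover have "X \<bullet> G X = (2 * \<mu> - \<omega> * \<xi>) * a\<^sup>2 - 2 * \<omega> * \<eta> * a + (2 * T - \<omega> * \<zeta>)"
    proof -
      have "X \<bullet> G X = (U \<bullet> G U) * a\<^sup>2 + 2 * (U \<bullet> G V) * (a * 1) + (V \<bullet> G V) * 1\<^sup>2"
        using quadratic_form_add[OF Gsa, of a U 1 V] X by metis
      then show ?thesis
        using U BU UBV by (simp add: G_def inner_diff_right \<eta>_def \<zeta>_def T_def \<xi>_def)
    qed
    ultimately show ?thesis by (simp add: A_def algebra_simps)
  qed
  moreover obtain v where v: "norm v = 1" "G v = lambda_min G *\<^sub>R v"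
    using lambda_min_variational(2)[OF Gsa] by blast
  ultimately have "L * (v \<bullet> v) \<le> lambda_min G * (v \<bullet> v)" by (metis inner_scaleR_right)
  then have "L \<le> lambda_min G" using v(1) by (simp add: norm_eq_1)
  then show "lambda_min (\<lambda>X. B X - \<omega> *\<^sub>R rank_one_op (sqrt \<gamma> *\<^sub>R U' + sqrt \<xi> *\<^sub>R U) X)
      \<le> lambda_min (\<lambda>X. B X - \<omega> *\<^sub>R C X)"
    by (simp add: L_def F_def G_def W_def)
qed

section \<open>Matrices under the Frobenius inner product\<close>

lemma inner_matrix_mult_left:
  fixes M X Y :: "real^'n^'n"
  shows "(M ** X) \<bullet> Y = X \<bullet> (transpose M ** Y)"
  unfolding frobenius_inner matrix_transpose_mul matrix_mul_assoc ..

lemma inner_transpose: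
  fixes X Y :: "real^'n^'n"
  shows "transpose X \<bullet> transpose Y = X \<bullet> Y"
  unfolding inner_vec_def transpose_def by (simp add: sum.swap[of "\<lambda>i j. X $ i $ j * Y $ i $ j"])

lemma inner_matrix_mult_right:
  fixes M X Y :: "real^'n^'n"
  shows "(X ** M) \<bullet> Y = X \<bullet> (Y ** transpose M)"
proof -
  have "(X ** M) \<bullet> Y = (transpose M ** transpose X) \<bullet> transpose Y"
    unfolding matrix_transpose_mul[symmetric] inner_transpose ..
  also have "\<dots> = transpose X \<bullet> transpose (Y ** transpose M)"
    unfolding inner_matrix_mult_left[of "transpose M"] matrix_transpose_mul transpose_transpose ..
  finally show ?thesis unfolding inner_transpose .
qed

lemma inner_matrix_vector_symmetric:
  fixes M :: "real^'n^'n"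
  assumes "transpose M = M"
  shows "(M *v x) \<bullet> y = x \<bullet> (M *v y)"
  by (metis assms dot_lmul_matrix transpose_matrix_vector)

lemma self_adjoint_matrix_vector:
  fixes M :: "real^'n^'n"
  assumes "transpose M = M"
  shows "self_adjoint ((*v) M)"
  by (rule self_adjointI) (simp_all add: inner_matrix_vector_symmetric[OF assms])

lemma inner_outer_right: "X \<bullet> outer v w = v \<bullet> (X *v w)"
  unfolding inner_vec_def outer_def matrix_vector_mult_def
  by (simp add: sum_distrib_left mult_ac)

lemma inner_outer_outer: "outer v w \<bullet> outer x y = (v \<bullet> x) * (w \<bullet> y)"
  unfolding inner_vec_def outer_def by (simp add: sum_product mult_ac)

lemma matrix_mult_outer: "M ** outer v w = outer (M *v v) w"
  unfolding outer_def matrix_matrix_mult_def matrix_vector_mult_def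
  by (simp add: vec_eq_iff sum_distrib_left mult_ac)

lemma outer_mult_matrix: "outer v w ** M = outer v (transpose M *v w)"
  unfolding outer_def matrix_matrix_mult_def matrix_vector_mult_def transpose_def
  by (simp add: vec_eq_iff sum_distrib_left mult_ac)

lemma outer_scaleR: "outer (a *\<^sub>R v) w = a *\<^sub>R outer v w" "outer v (a *\<^sub>R w) = a *\<^sub>R outer v w"
  unfolding outer_def by (simp_all add: vec_eq_iff)

lemma inner_matrix_columns:
  fixes X Y :: "real^'n^'n"
  shows "X \<bullet> Y = (\<Sum>j\<in>UNIV. column j X \<bullet> column j Y)"
  unfolding inner_vec_def column_def by (simp add: sum.swap[of "\<lambda>i j. X $ i $ j * Y $ i $ j"])

text \<open>Bessel's inequality: in an orthonormal basis starting with \<open>u\<close>, the two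
  terms are the squared norms of the first row and first column of \<open>X\<close>, which meet only
  in a zero entry. \<open>Z\<close> is what remains after removing both.\<close>

lemma norm_row_plus_column_le:
  fixes X :: "real^'n^'n"
  assumes u: "norm u = 1" and orth: "u \<bullet> (X *v u) = 0"
  shows "(transpose X *v u) \<bullet> (transpose X *v u) + (X *v u) \<bullet> (X *v u) \<le> X \<bullet> X"
proof -
  let ?r = "transpose X *v u" and ?c = "X *v u"
  have uu: "u \<bullet> u = 1" using u by (simp add: norm_eq_1)
  have ur: "u \<bullet> ?r = 0" and rX: "u \<bullet> (X *v ?r) = ?r \<bullet> ?r"
    using orth by (metis dot_lmul_matrix inner_commute transpose_matrix_vector)+
  define Z where "Z = X - outer u ?r - outer ?c u"
  have "0 \<le> Z \<bullet> Z" by simp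
  also have "Z \<bullet> Z = X \<bullet> X - ?r \<bullet> ?r - ?c \<bullet> ?c"
    using uu ur rX orth inner_outer_right[of X u ?r] inner_outer_right[of X ?c u]
      inner_commute[of "outer u ?r" X] inner_commute[of "outer ?c u" X]
    unfolding Z_def by (simp add: inner_diff inner_outer_outer inner_commute)
  finally show ?thesis by simp
qed

text \<open>Columnwise, \<open>M\<close> dominates \<mu>' times the identity minus (\<mu>' - \<mu>)
  times the projector onto \<open>u\<close>.\<close>

lemma quadratic_form_mult_left_ge:
  fixes M X :: "real^'n^'n"
  assumes M: "transpose M = M" and u: "norm u = 1" "M *v u = \<mu> *\<^sub>R u"
    and gap: "\<And>y. u \<bullet> y = 0 \<Longrightarrow> \<mu>' * (y \<bullet> y) \<le> y \<bullet> (M *v y)"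
  shows "\<mu>' * (X \<bullet> X) - (\<mu>' - \<mu>) * ((transpose X *v u) \<bullet> (transpose X *v u)) \<le> X \<bullet> (M ** X)"
proof -
  have uu: "u \<bullet> u = 1" using u by (simp add: norm_eq_1)
  have col: "\<mu>' * (x \<bullet> x) - (\<mu>' - \<mu>) * (u \<bullet> x)\<^sup>2 \<le> x \<bullet> (M *v x)" for x
  proof -
    define a y where "a = u \<bullet> x" and "y = x - a *\<^sub>R u"
    have uy: "u \<bullet> y = 0" using uu by (simp add: y_def a_def inner_diff_right)
    have x: "x = a *\<^sub>R u + 1 *\<^sub>R y" by (simp add: y_def)
    have "u \<bullet> (M *v y) = 0"
      using inner_matrix_vector_symmetric[OF M, of u y] u uy by simp
    then have "x \<bullet> (M *v x) = \<mu> * a\<^sup>2 + y \<bullet> (M *v y)"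
      using quadratic_form_add[OF self_adjoint_matrix_vector[OF M], of a u 1 y] x u uu by simp
    moreover have "x \<bullet> x = a\<^sup>2 + y \<bullet> y"
      using uu uy by (simp add: y_def a_def inner_diff power2_eq_square inner_commute algebra_simps)
    ultimately show ?thesis using gap[OF uy] by (simp add: a_def[symmetric] algebra_simps)
  qed
  have "column j (M ** X) = M *v column j X" for j
    by (simp add: column_def matrix_matrix_mult_def matrix_vector_mult_def vec_eq_iff)
  then have "X \<bullet> (M ** X) = (\<Sum>j\<in>UNIV. column j X \<bullet> (M *v column j X))"
    by (simp add: inner_matrix_columns)
  also have "\<dots> \<ge> (\<Sum>j\<in>UNIV. \<mu>' * (column j X \<bullet> column j X) - (\<mu>' - \<mu>) * (u \<bullet> column j X)\<^sup>2)"
    by (intro sum_mono col)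
  also have "(\<Sum>j\<in>UNIV. (u \<bullet> column j X)\<^sup>2) = (transpose X *v u) \<bullet> (transpose X *v u)"
    by (simp add: inner_vec_def column_def matrix_vector_mult_def transpose_def power2_eq_square mult_ac)
  then have "(\<Sum>j\<in>UNIV. \<mu>' * (column j X \<bullet> column j X) - (\<mu>' - \<mu>) * (u \<bullet> column j X)\<^sup>2)
      = \<mu>' * (X \<bullet> X) - (\<mu>' - \<mu>) * ((transpose X *v u) \<bullet> (transpose X *v u))"
    by (simp add: sum_subtractf sum_distrib_left[symmetric] inner_matrix_columns[symmetric])
  finally show ?thesis by simp
qed

text \<open>Left and right multiplication each give \<mu>' up to a deficit along \<open>u\<close>;
  the row and column bound limits the total deficit to \<mu>' - \<mu>, leaving 2 \<mu>' - (\<mu>' -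
  \<mu>) = \<mu> + \<mu>'.\<close>

lemma quadratic_form_two_sided_ge:
  fixes M X :: "real^'n^'n"
  assumes M: "transpose M = M" and u: "norm u = 1" "M *v u = \<mu> *\<^sub>R u" and le: "\<mu> \<le> \<mu>'"
    and gap: "\<And>y. u \<bullet> y = 0 \<Longrightarrow> \<mu>' * (y \<bullet> y) \<le> y \<bullet> (M *v y)"
    and orth: "outer u u \<bullet> X = 0"
  shows "(\<mu> + \<mu>') * (X \<bullet> X) \<le> X \<bullet> (M ** X + X ** M)"
proof -
  let ?r = "transpose X *v u" and ?c = "X *v u"
  have 1: "\<mu>' * (X \<bullet> X) - (\<mu>' - \<mu>) * (?r \<bullet> ?r) \<le> X \<bullet> (M ** X)"
    using quadratic_form_mult_left_ge[OF M u gap, of X] by simp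
  have "X \<bullet> (X ** M) = transpose X \<bullet> (M ** transpose X)"
    using inner_transpose[of X "X ** M"] M by (simp add: matrix_transpose_mul)
  then have 2: "\<mu>' * (X \<bullet> X) - (\<mu>' - \<mu>) * (?c \<bullet> ?c) \<le> X \<bullet> (X ** M)"
    using quadratic_form_mult_left_ge[OF M u gap, of "transpose X"] inner_transpose[of X X] by simp
  have "u \<bullet> (X *v u) = 0"
    using orth inner_outer_right[of X u u] by (simp add: inner_commute)
  from norm_row_plus_column_le[OF u(1) this]
  have "(\<mu>' - \<mu>) * (?r \<bullet> ?r + ?c \<bullet> ?c) \<le> (\<mu>' - \<mu>) * (X \<bullet> X)"
    using le by (intro mult_left_mono) auto
  then show ?thesis using 1 2 by (simp add: inner_add_right algebra_simps)
qed

lemma linear_matrix_mult: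
  fixes M :: "real^'n^'n"
  shows linear_matrix_mult_left: "linear (\<lambda>X :: real^'n^'n. M ** X)"
    and linear_matrix_mult_right: "linear (\<lambda>X :: real^'n^'n. X ** M)"
  by (auto intro!: linearI simp: matrix_matrix_mult_def vec_eq_iff sum.distrib algebra_simps
      sum_distrib_left)

section \<open>The superoperators of a random projector\<close>

lemma mean_matrix_symmetric:
  assumes "finite (set_pmf D)" "\<And>Q. Q \<in> set_pmf D \<Longrightarrow> transpose Q = Q"
  shows "transpose (mean_matrix D) = mean_matrix D"
proof -
  have "mean_matrix D = (\<Sum>Q\<in>set_pmf D. pmf D Q *\<^sub>R Q)"
    unfolding mean_matrix_def by (rule integral_measure_pmf[OF assms(1)])
  then show ?thesis
    using assms(2) by (simp add: vec_eq_iff transpose_def)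
qed

lemma op_B_self_adjoint:
  assumes "transpose (mean_matrix D) = mean_matrix D"
  shows "self_adjoint (op_B D)"
proof (rule self_adjointI)
  show "linear (op_B D)"
    unfolding op_B_def[abs_def] by (intro linear_compose_add linear_matrix_mult)
  show "op_B D X \<bullet> Y = X \<bullet> op_B D Y" for X Y
    by (simp add: op_B_def inner_add inner_matrix_mult_left[of "mean_matrix D"]
        inner_matrix_mult_right[of _ "mean_matrix D"] assms)
qed

text \<open>For each projector \<open>Q\<close> the form of \<open>C\<close> is the squared norm of
  \<open>Q X Q\<close>, and twice the form of \<open>B/2 - C\<close> is the squared norm of the
  commutator of \<open>Q\<close> and \<open>X\<close>.\<close>

lemma op_C_in_frak_C:
  fixes D :: "(real^'n^'n) pmf"
  assumes fin: "finite (set_pmf D)" and proj: "\<And>Q. Q \<in> set_pmf D \<Longrightarrow> orthogonal_projector Q"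
  shows "op_C D \<in> frak_C (op_B D) U (U \<bullet> op_C D U)"
proof -
  let ?S = "set_pmf D"
  have tr: "transpose Q = Q" and idem: "Q ** Q = Q" if "Q \<in> ?S" for Q
    using proj[OF that] by (auto simp: orthogonal_projector_def)
  have C: "op_C D X = (\<Sum>Q\<in>?S. pmf D Q *\<^sub>R (Q ** X ** Q))" for X
    unfolding op_C_def by (rule integral_measure_pmf[OF fin])
  have M: "mean_matrix D = (\<Sum>Q\<in>?S. pmf D Q *\<^sub>R Q)"
    unfolding mean_matrix_def by (rule integral_measure_pmf[OF fin])
  have B: "op_B D X = (\<Sum>Q\<in>?S. pmf D Q *\<^sub>R (Q ** X + X ** Q))" for X
  proof -
    have lin: "linear (\<lambda>Q. Q ** X + X ** Q)"
      by (intro linear_compose_add linear_matrix_mult)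
    show ?thesis
      using linear_sum[OF lin, of "\<lambda>Q. pmf D Q *\<^sub>R Q" ?S]
      by (simp only: op_B_def M linear_scale[OF lin])
  qed
  have Csa: "self_adjoint (op_C D)"
  proof (rule self_adjointI)
    show "linear (op_C D)"
      unfolding C[abs_def]
      by (intro linear_compose_sum linear_compose_scale_right ballI
          linear_compose[OF linear_matrix_mult_left linear_matrix_mult_right, unfolded o_def])
    have "(Q ** X ** Q) \<bullet> Y = X \<bullet> (Q ** Y ** Q)" if "Q \<in> ?S" for Q X Y
      by (simp add: inner_matrix_mult_left[of Q] inner_matrix_mult_right[of _ Q] tr[OF that] matrix_mul_assoc)
    then show "op_C D X \<bullet> Y = X \<bullet> op_C D Y" for X Y
      by (simp add: C inner_sum_left inner_sum_right)
  qed
  have "0 \<le> X \<bullet> op_C D X" for X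
  proof -
    have "X \<bullet> (Q ** X ** Q) = (Q ** X ** Q) \<bullet> (Q ** X ** Q)" if "Q \<in> ?S" for Q
    proof -
      have "(Q ** X ** Q) \<bullet> (Q ** X ** Q) = X \<bullet> (Q ** Q ** X ** (Q ** Q))"
        by (simp add: inner_matrix_mult_left[of Q] inner_matrix_mult_right[of _ Q] tr[OF that] matrix_mul_assoc)
      then show ?thesis using idem[OF that] by simp
    qed
    then show ?thesis
      by (simp add: C inner_sum_right sum_nonneg)
  qed
  then have Cnn: "pos_semidefinite (op_C D)" using Csa by (simp add: pos_semidefinite_def)
  have Bsa: "self_adjoint (op_B D)"
    by (rule op_B_self_adjoint[OF mean_matrix_symmetric[OF fin tr]])
  have dsa: "self_adjoint (\<lambda>X. op_B D X /\<^sub>R 2 - op_C D X)"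
  proof (rule self_adjointI)
    show "linear (\<lambda>X. op_B D X /\<^sub>R 2 - op_C D X)"
      using Bsa Csa by (intro linear_compose_sub linear_compose_scale_right self_adjoint_linear)
    show "(op_B D X /\<^sub>R 2 - op_C D X) \<bullet> Y = X \<bullet> (op_B D Y /\<^sub>R 2 - op_C D Y)" for X Y
      using Bsa Csa by (simp add: inner_diff self_adjoint_inner)
  qed
  have "0 \<le> X \<bullet> (op_B D X /\<^sub>R 2 - op_C D X)" for X
  proof -
    have sq: "X \<bullet> (Q ** X + X ** Q) - 2 * (X \<bullet> (Q ** X ** Q)) = (Q ** X - X ** Q) \<bullet> (Q ** X - X ** Q)"
      if "Q \<in> ?S" for Q
    proof -
      have "(Q ** X) \<bullet> (Q ** X) = X \<bullet> (Q ** X)"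
        by (simp add: inner_matrix_mult_left[of Q] tr[OF that] matrix_mul_assoc idem[OF that])
      moreover have "(X ** Q) \<bullet> (X ** Q) = X \<bullet> (X ** Q)"
        by (simp add: inner_matrix_mult_right[of _ Q] tr[OF that] idem[OF that] flip: matrix_mul_assoc)
      moreover have "(Q ** X) \<bullet> (X ** Q) = X \<bullet> (Q ** X ** Q)"
        by (simp add: inner_matrix_mult_left[of Q] tr[OF that] matrix_mul_assoc)
      ultimately show ?thesis
        by (simp add: inner_add_right inner_diff inner_commute[of "X ** Q" "Q ** X"])
    qed
    have "2 * (X \<bullet> (op_B D X /\<^sub>R 2 - op_C D X))
        = (\<Sum>Q\<in>?S. pmf D Q * (X \<bullet> (Q ** X + X ** Q) - 2 * (X \<bullet> (Q ** X ** Q))))"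
      by (simp add: B C inner_diff_right inner_sum_right sum_subtractf sum_distrib_left
          right_diff_distrib mult_ac)
    also have "\<dots> = (\<Sum>Q\<in>?S. pmf D Q * ((Q ** X - X ** Q) \<bullet> (Q ** X - X ** Q)))"
      by (intro sum.cong) (simp_all add: sq)
    also have "0 \<le> \<dots>" by (simp add: sum_nonneg)
    finally show ?thesis by simp
  qed
  then have BC: "pos_semidefinite (\<lambda>X. op_B D X /\<^sub>R 2 - op_C D X)"
    using dsa by (simp add: pos_semidefinite_def)
  \<comment> \<open>The identity matrix witnesses the contact: both \<open>\<B>/2\<close> and \<open>\<C>\<close> send it to the mean.\<close>
  have "op_C D (mat 1) = mean_matrix D"
    unfolding C M by (intro sum.cong) (simp_all add: idem)
  then have "op_B D (mat 1) /\<^sub>R 2 - op_C D (mat 1) = 0"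
    by (simp add: op_B_def flip: scaleR_2)
  moreover have "(mat 1 :: real^'n^'n) \<noteq> 0" by (simp add: mat_def vec_eq_iff)
  ultimately have "\<not> pos_definite (\<lambda>X. op_B D X /\<^sub>R 2 - op_C D X)"
    unfolding pos_definite_def by (metis inner_zero_right less_irrefl)
  then show ?thesis
    using Csa Cnn BC by (simp add: frak_C_def loewner_le_def kisses_def)
qed

theorem theorem2:
  fixes D :: "(real^'n^'n) pmf"
    and u u' :: "real^'n"
    and \<mu> \<mu>' :: real
  assumes "CARD('n) \<ge> 2"
    and "finite (set_pmf D)"
    and "\<And>Q. Q \<in> set_pmf D \<Longrightarrow> orthogonal_projector Q"
    and "\<mu> = eigenvalue_list ((*v) (mean_matrix D)) ! 0"
    and "\<mu>' = eigenvalue_list ((*v) (mean_matrix D)) ! 1"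
    and "\<mu> > 0"
    and "norm u = 1" and "norm u' = 1" and "u \<bullet> u' = 0"
    and "mean_matrix D *v u = \<mu> *\<^sub>R u"
    and "mean_matrix D *v u' = \<mu>' *\<^sub>R u'"
  shows "(\<forall>C' \<in> frak_C (op_B D) (outer u u) (outer u u \<bullet> op_C D (outer u u)).
            eclipses (op_B D) (op_Cstar D \<mu> \<mu>' u u') C')
       \<and> eclipses (op_B D) (op_Cstar D \<mu> \<mu>' u u') (op_C D)"
proof -
  let ?M = "mean_matrix D" and ?U = "outer u u" and ?U' = "outer u u'"
  have M: "transpose ?M = ?M"
    using assms(2,3) by (intro mean_matrix_symmetric) (auto simp: orthogonal_projector_def)
  have uu: "u \<bullet> u = 1" "u' \<bullet> u' = 1" using assms by (simp_all add: norm_eq_1)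
  have "u' \<noteq> 0" using uu by auto
  note eig = quadratic_form_second_eigenvalue[OF self_adjoint_matrix_vector[OF M] assms(7)
      assms(10)[unfolded assms(4)] this assms(9), folded assms(4,5)]
  \<comment> \<open>The unsimplified shape matches \<open>2 * s\<close> in
    \<open>kissing_rank_one_eclipses\<close> with \<open>s = (\<mu> + \<mu>') / 2\<close>.\<close>
  have two_s: "2 * ((\<mu> + \<mu>') / 2) = \<mu> + \<mu>'" by simp
  have gap: "2 * ((\<mu> + \<mu>') / 2) * (V \<bullet> V) \<le> V \<bullet> op_B D V" if "?U \<bullet> V = 0" for V
    using quadratic_form_two_sided_ge[OF M assms(7,10) eig that] by (simp only: op_B_def two_s)
  have BU: "op_B D ?U = (2 * \<mu>) *\<^sub>R ?U" "op_B D ?U' = (2 * ((\<mu> + \<mu>') / 2)) *\<^sub>R ?U'"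
    unfolding two_s
    by (simp_all add: op_B_def matrix_mult_outer outer_mult_matrix M assms(10,11) outer_scaleR
        scaleR_add_left flip: scaleR_2)
  have all: "eclipses (op_B D) (op_Cstar D \<mu> \<mu>' u u') C'"
    if C': "C' \<in> frak_C (op_B D) ?U (?U \<bullet> op_C D ?U)" for C'
  proof -
    have "pos_semidefinite C'" "C' \<preceq>\<^sub>L (\<lambda>X. op_B D X /\<^sub>R 2)" and \<xi>: "?U \<bullet> C' ?U = ?U \<bullet> op_C D ?U"
      using C' by (auto simp: frak_C_def loewner_le_def)
    from kissing_rank_one_eclipses[OF op_B_self_adjoint[OF M] this(1,2) _ _ _ BU assms(6) _ gap]
    have "eclipses (op_B D) (rank_one_op (sqrt ((\<mu> + \<mu>') / 2 * (1 - ?U \<bullet> C' ?U / \<mu>)) *\<^sub>R ?U'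
        + sqrt (?U \<bullet> C' ?U) *\<^sub>R ?U)) C'"
      using uu assms(9) eig(1) by (simp add: inner_outer_outer)
    \<comment> \<open>The rank-one map was built from \<open>C'\<close>; condition (d) identifies
      its \<xi> with that of \<open>op_C D\<close>, so it is the same map for every
      \<open>C'\<close>.\<close>
    then show ?thesis
      unfolding \<xi> by (simp add: op_Cstar_def gamma_coeff_def Let_def)
  qed
  then show ?thesis using op_C_in_frak_C[OF assms(2,3)] by blast
qed

end
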